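(* Let $F: Q \to \mathbf{E}^*$ be a continuous, bounded, and $\delta$-monotone operator. Let $g(x) = \max_{1 \leq i \leq p} g_i(x)$ be an $M_g$-Lipschitz convex function, where each $g_i: Q \to \mathbb{R}$, $i=1,\dots,p$, is an $M_{g_i}$-Lipschitz convex function and $M_g = \max_{1 \leq i \leq p} M_{g_i}$. Consider the constrained variational inequality problem "find $x^*\in Q$ with $\langle F(x),x^*-x\rangle\le 0$ for all $x\in Q$ and $g(x^* )\le 0$", assumed to have a solution. Let $\varepsilon>0$, let $m\ge -1$ be fixed, let $N\ge 1$ and $x^1\in Q$, and run $N$ iterations of the switching mirror descent algorithm (described in the context) with step sizes $\{\gamma_k^F\}$, $\{\gamma_k^g\}$ such that the sequence $\gamma_k$ (equal to $\gamma_k^F$ if $k\in I$ and to $\gamma_k^g$ if $k\in J$) is positive and non-increasing, where $I$ and $J$ are the sets of productive and non-productive step indices in $\{1,\dots,N\}$, and $I\neq\emptyset$. Set $$\widehat{x} = \frac{1}{\sum_{k \in I} (\gamma_k^F)^{-m}} \sum_{k \in I} (\gamma_k^F)^{-m}x^k .$$ Then $$\operatorname{Gap} (\widehat{x}) < \frac{1}{\sum_{k \in I} (\gamma_k^F)^{-m}} \Bigg( \frac{R}{\gamma_N^{m+1}} + \frac{1}{2 \sigma} \sum_{k\in I} \frac{\|F(x^k)\|_*^2}{(\gamma_k^F)^{m -1}} + \frac{1}{2 \sigma} \sum_{k\in J} \frac{\|\nabla g(x^k)\|_*^2}{(\gamma_k^g)^{m -1}} - (\varepsilon - M_g D)\sum_{k\in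 J} (\gamma_k^g)^{-m} \Bigg) + \delta.$$
   Context: $(\mathbf{E},\|\cdot\|)$ is a finite-dimensional normed real vector space (arbitrary norm), $\mathbf{E}^*$ its dual with norm $\|y\|_*=\max\{\langle y,x\rangle : \|x\|\le 1\}$, where $\langle y,x\rangle$ is the value of $y\in\mathbf{E}^*$ at $x\in\mathbf{E}$. $Q\subset\mathbf{E}$ is a (nonempty) convex compact set with diameter $D>0$, i.e. $\max_{x,y\in Q}\|x-y\|\le D$. The prox-function $\psi:Q\to\mathbb{R}$ is proper, closed, differentiable and $\sigma$-strongly convex ($\sigma>0$) with respect to $\|\cdot\|$; its Bregman divergence is $V_\psi(x,y)=\psi(x)-\psi(y)-\langle\nabla\psi(y),x-y\rangle$ for $x,y\in Q$. It is assumed that $R>0$ is a constant with $V_\psi(x,y)\le R<\infty$ for all $x,y\in Q$. The operator $F:Q\to\mathbf{E}^*$ is $\delta$-monotone if $\langle F(y)-F(x),y-x\rangle\ge-\delta$ for all $x,y\in Q$, where $\delta\ge 0$ (the case $\delta=0$ is ordinary monotonicity). It is bounded if there is $L_F>0$ with $\|F(x)\|_*\le L_F$ for all $x\in Q$. The functions $g_i$ are convex and subdifferentiable on $Q$, with $|g_i(x)-g_i(y)|\le M_{g_i}\|x-y\|$ for $x,y\in Q$, $M_{g_i}>0$; $\nabla g(x)\in\partial g(x)$ denotes a subgradient of $g$ at $x$ with $\|\nabla g(x)\|_*\le M_g$. The restricted gap function is $\operatorname{Gap}(\widehat{x})=\max_{u\in Q}\langle F(u),\widehat{x}-u\rangle$.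 Switching mirror descent algorithm. Input: $\varepsilon>0$, $x^1\in Q$, positive step sizes $\{\gamma_k^F\}_{k\ge1}$, $\{\gamma_k^g\}_{k\ge1}$, number of iterations $N$. Start with $I=J=\emptyset$. For $k=1,\dots,N$: if $g(x^k)\le\varepsilon$ (productive step), put $x^{k+1}=\arg\min_{x\in Q}\{\langle F(x^k),x\rangle+\frac{1}{\gamma_k^F}V_\psi(x,x^k)\}$ and add $k$ to $I$; otherwise (non-productive step), choose $\nabla g(x^k)\in\partial g(x^k)$, put $x^{k+1}=\arg\min_{x\in Q}\{\langle\nabla g(x^k),x\rangle+\frac{1}{\gamma_k^g}V_\psi(x,x^k)\}$ and add $k$ to $J$.
   Formalization: The strict inequality is false when J is empty (e.g. Q=[0,1], ψ=x²/2, F=1, g=x−1, N=1, γ=1, x¹=1, R=1/2 gives equality); what is proved is Gap(x̂) ≤ the bound always, and the strict inequality whenever J is nonempty. *)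

theory Defs
  imports "HOL-Analysis.Analysis"
begin

text \<open>
  The dual of a finite-dimensional normed space \<open>'a\<close> is the type \<open>'a \<Rightarrow>\<^sub>L real\<close> of bounded linear
  functionals: \<open>blinfun_apply y x\<close> is the pairing of \<open>y\<close> with \<open>x\<close>, and \<open>norm y\<close> (the operator norm)
  is the dual norm. All functions on \<open>Q\<close> are total in HOL; only their values on \<open>Q\<close> matter.
\<close>

definition delta_monotone_on ::
    "'a::real_normed_vector set \<Rightarrow> real \<Rightarrow> ('a \<Rightarrow> 'a \<Rightarrow>\<^sub>L real) \<Rightarrow> bool" where
  "delta_monotone_on Q \<delta> F \<longleftrightarrow>
     (\<forall>x\<in>Q. \<forall>y\<in>Q. blinfun_apply (F y - F x) (y - x) \<ge> - \<delta>)"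

definition strongly_convex_on ::
    "'a::real_normed_vector set \<Rightarrow> real \<Rightarrow> ('a \<Rightarrow> real) \<Rightarrow> bool" where
  "strongly_convex_on Q \<sigma> f \<longleftrightarrow>
     (\<forall>x\<in>Q. \<forall>y\<in>Q. \<forall>t\<in>{0..1}.
        f (t *\<^sub>R x + (1 - t) *\<^sub>R y)
          \<le> t * f x + (1 - t) * f y - \<sigma> / 2 * t * (1 - t) * (norm (x - y))\<^sup>2)"

text \<open>
  \<open>d\<psi>\<close> is a gradient of \<open>\<psi>\<close> on \<open>Q\<close>, with derivatives taken within \<open>Q\<close>. If \<open>Q\<close> has empty interior
  it need not be unique, but for convex \<open>Q\<close> its value at \<open>y \<in> Q\<close> in the directions \<open>x - y\<close>, \<open>x \<in> Q\<close>,
  is, so the Bregman divergence below does not depend on the choice.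
\<close>

definition gradient_on ::
    "'a::real_normed_vector set \<Rightarrow> ('a \<Rightarrow> real) \<Rightarrow> ('a \<Rightarrow> 'a \<Rightarrow>\<^sub>L real) \<Rightarrow> bool" where
  "gradient_on Q \<psi> d\<psi> \<longleftrightarrow>
     (\<forall>y\<in>Q. (\<psi> has_derivative blinfun_apply (d\<psi> y)) (at y within Q))"

definition bregman ::
    "('a::real_normed_vector \<Rightarrow> real) \<Rightarrow> ('a \<Rightarrow> 'a \<Rightarrow>\<^sub>L real) \<Rightarrow> 'a \<Rightarrow> 'a \<Rightarrow> real" where
  "bregman \<psi> d\<psi> x y = \<psi> x - \<psi> y - blinfun_apply (d\<psi> y) (x - y)"

definition subdifferential ::
    "'a::real_normed_vector set \<Rightarrow> ('a \<Rightarrow> real) \<Rightarrow> 'a \<Rightarrow> ('a \<Rightarrow>\<^sub>L real) set" where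
  "subdifferential Q f x = {y. \<forall>z\<in>Q. f z \<ge> f x + blinfun_apply y (z - x)}"

definition vi_solution ::
    "'a::real_normed_vector set \<Rightarrow> ('a \<Rightarrow> 'a \<Rightarrow>\<^sub>L real) \<Rightarrow> ('a \<Rightarrow> real) \<Rightarrow> 'a \<Rightarrow> bool" where
  "vi_solution Q F g xs \<longleftrightarrow>
     xs \<in> Q \<and> (\<forall>x\<in>Q. blinfun_apply (F x) (xs - x) \<le> 0) \<and> g xs \<le> 0"

text \<open>The supremum is a maximum for continuous \<open>F\<close> on nonempty compact \<open>Q\<close>.\<close>

definition Gap ::
    "'a::real_normed_vector set \<Rightarrow> ('a \<Rightarrow> 'a \<Rightarrow>\<^sub>L real) \<Rightarrow> 'a \<Rightarrow> real" where
  "Gap Q F xh = (SUP u\<in>Q. blinfun_apply (F u) (xh - u))"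

text \<open>
  One mirror descent step from \<open>xk\<close> along \<open>y\<close> with step size \<open>\<gamma>\<close>: \<open>xnext\<close> minimizes the
  linearized objective over \<open>Q\<close>.
\<close>

definition mirror_step ::
    "'a::real_normed_vector set \<Rightarrow> ('a \<Rightarrow> real) \<Rightarrow> ('a \<Rightarrow> 'a \<Rightarrow>\<^sub>L real)
      \<Rightarrow> ('a \<Rightarrow>\<^sub>L real) \<Rightarrow> real \<Rightarrow> 'a \<Rightarrow> 'a \<Rightarrow> bool" where
  "mirror_step Q \<psi> d\<psi> y \<gamma> xk xnext \<longleftrightarrow>
     is_arg_min (\<lambda>z. blinfun_apply y z + 1 / \<gamma> * bregman \<psi> d\<psi> z xk) (\<lambda>z. z \<in> Q) xnext"

text \<open>
  \<open>x 1, \<dots>, x (N + 1)\<close> are iterates of \<open>N\<close> steps of the switching method. The sequence \<open>G\<close> records the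
  subgradients chosen by the method; it is only constrained at the non-productive steps.
\<close>

definition switching_mirror_descent ::
    "'a::real_normed_vector set \<Rightarrow> ('a \<Rightarrow> real) \<Rightarrow> ('a \<Rightarrow> 'a \<Rightarrow>\<^sub>L real)
      \<Rightarrow> ('a \<Rightarrow> 'a \<Rightarrow>\<^sub>L real) \<Rightarrow> ('a \<Rightarrow> real) \<Rightarrow> real \<Rightarrow> (nat \<Rightarrow> real) \<Rightarrow> (nat \<Rightarrow> real)
      \<Rightarrow> nat \<Rightarrow> (nat \<Rightarrow> 'a) \<Rightarrow> (nat \<Rightarrow> 'a \<Rightarrow>\<^sub>L real) \<Rightarrow> bool" where
  "switching_mirror_descent Q \<psi> d\<psi> F g \<epsilon> \<gamma>F \<gamma>g N x G \<longleftrightarrow>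
     x 1 \<in> Q \<and>
     (\<forall>k\<in>{1..N}.
        if g (x k) \<le> \<epsilon>
        then mirror_step Q \<psi> d\<psi> (F (x k)) (\<gamma>F k) (x k) (x (k + 1))
        else G k \<in> subdifferential Q g (x k) \<and>
             mirror_step Q \<psi> d\<psi> (G k) (\<gamma>g k) (x k) (x (k + 1)))"

definition productive_steps :: "('a \<Rightarrow> real) \<Rightarrow> real \<Rightarrow> nat \<Rightarrow> (nat \<Rightarrow> 'a) \<Rightarrow> nat set" where
  "productive_steps g \<epsilon> N x = {k\<in>{1..N}. g (x k) \<le> \<epsilon>}"

definition nonproductive_steps :: "('a \<Rightarrow> real) \<Rightarrow> real \<Rightarrow> nat \<Rightarrow> (nat \<Rightarrow> 'a) \<Rightarrow> nat set" where
  "nonproductive_steps g \<epsilon> N x = {k\<in>{1..N}. \<not> g (x k) \<le> \<epsilon>}"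

end

theory Submission
  imports Defs
begin

text \<open>
  First-order optimality of a mirror step together with strong convexity of the prox-function
  gives \<open>y (x\<^sub>k - u) \<le> (V (u, x\<^sub>k) - V (u, x\<^sub>k\<^sub>+\<^sub>1)) / \<gamma> + \<gamma> \<parallel>y\<parallel>\<^sup>2 / (2 \<sigma>)\<close> for every \<open>u \<in> Q\<close>. Multiplying
  by \<open>\<gamma>\<^sub>k\<close> to the power \<open>-m\<close> and summing, the divergences telescope up to \<open>R\<close> times the last weight,
  because the weights \<open>\<gamma>\<^sub>k\<close> to the power \<open>-(m + 1)\<close> increase. On productive steps \<open>\<delta>\<close>-monotonicity
  replaces \<open>F x\<^sub>k\<close> by \<open>F u\<close>. On nonproductive ones \<open>G\<^sub>k (x\<^sub>k - u) \<ge> g x\<^sub>k - g u\<close>, where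
  \<open>g u \<le> M\<^sub>g D\<close> by comparison with a solution; the slack \<open>g x\<^sub>k - \<epsilon> > 0\<close> does not depend on \<open>u\<close>,
  so the strict inequality survives the supremum over \<open>u\<close>.
\<close>

section \<open>Directional derivatives on a convex set\<close>

text \<open>Convexity keeps the segment from \<open>y\<close> to \<open>z\<close> inside
  \<open>Q\<close>, so the chain rule applies with derivatives taken within \<open>Q\<close>. The
  limit is one-sided, which covers boundary points and sets with empty interior.\<close>

lemma has_derivative_within_convex_directional:
  fixes f :: "'a::real_normed_vector \<Rightarrow> real"
  assumes "convex Q" "y \<in> Q" "z \<in> Q" "(f has_derivative f') (at y within Q)"
  shows "((\<lambda>t. (f (y + t *\<^sub>R (z - y)) - f y) / t) \<longlongrightarrow> f' (z - y)) (at_right 0)"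
proof -
  let ?p = "\<lambda>t::real. y + t *\<^sub>R (z - y)"
  have img: "?p ` {0..1} \<subseteq> Q"
    using convexD_alt[OF assms(1,2,3)] by (auto simp: algebra_simps)
  have dp: "(?p has_derivative (\<lambda>t. t *\<^sub>R (z - y))) (at 0 within {0..1})"
    by (auto intro!: derivative_eq_intros)
  have "(f has_derivative f') (at (?p 0) within ?p ` {0..1})"
    using has_derivative_subset[OF assms(4) img] by simp
  from has_derivative_in_compose[OF dp this]
  have "((\<lambda>t. f (?p t)) has_derivative (\<lambda>t. f' (t *\<^sub>R (z - y)))) (at 0 within {0..1})" .
  moreover have "(\<lambda>t. f' (t *\<^sub>R (z - y))) = (*) (f' (z - y))"
    using linear_scale[OF has_derivative_linear[OF assms(4)]] by (auto simp: mult.commute)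
  ultimately have "((\<lambda>t. f (?p t)) has_field_derivative f' (z - y)) (at 0 within {0..1})"
    by (simp add: has_field_derivative_def)
  then show ?thesis
    by (simp add: has_field_derivative_iff at_within_Icc_at_right)
qed

text \<open>The difference quotients along a segment starting at the minimizer are nonnegative,
  hence so is their limit.\<close>

lemma is_arg_min_convex_derivative_nonneg:
  fixes f :: "'a::real_normed_vector \<Rightarrow> real"
  assumes "convex Q" "is_arg_min f (\<lambda>z. z \<in> Q) y" "u \<in> Q"
    and "(f has_derivative f') (at y within Q)"
  shows "f' (u - y) \<ge> 0"
proof (rule tendsto_lowerbound)
  have y: "y \<in> Q" and min: "\<And>z. z \<in> Q \<Longrightarrow> f y \<le> f z"
    using assms(2) by (auto simp: is_arg_min_def not_less)
  show "((\<lambda>t. (f (y + t *\<^sub>R (u - y)) - f y) / t) \<longlongrightarrow> f' (u - y)) (at_right 0)"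
    using has_derivative_within_convex_directional[OF assms(1) y assms(3,4)] .
  have "f y \<le> f (y + t *\<^sub>R (u - y))" if "0 < t" "t < 1" for t
    using convexD_alt[OF assms(1) y assms(3), of t] that
    by (intro min) (auto simp: algebra_simps)
  then show "eventually (\<lambda>t. 0 \<le> (f (y + t *\<^sub>R (u - y)) - f y) / t) (at_right 0)"
    unfolding eventually_at_right_field by (intro exI[of _ 1]) auto
qed simp

lemma bregman_strongly_convex_ge:
  assumes "convex Q" "gradient_on Q \<psi> d\<psi>" "strongly_convex_on Q \<sigma> \<psi>" "x \<in> Q" "y \<in> Q"
  shows "\<sigma> / 2 * (norm (x - y))\<^sup>2 \<le> bregman \<psi> d\<psi> x y"
proof -
  \<comment> \<open>\<open>?c t\<close> is the right side of the strong convexity inequality at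
    parameter \<open>t\<close> after subtracting \<open>\<psi> y\<close> and dividing by
    \<open>t\<close>. As \<open>t\<close> tends to 0, the factor \<open>1 - t\<close> disappears and
    the full constant \<open>\<sigma> / 2\<close> remains.\<close>
  let ?c = "\<lambda>t::real. \<psi> x - \<psi> y - \<sigma> / 2 * (1 - t) * (norm (x - y))\<^sup>2"
  have "blinfun_apply (d\<psi> y) (x - y) \<le> ?c 0"
  proof (rule tendsto_le)
    show "((\<lambda>t. (\<psi> (y + t *\<^sub>R (x - y)) - \<psi> y) / t) \<longlongrightarrow> blinfun_apply (d\<psi> y) (x - y)) (at_right 0)"
      using assms by (intro has_derivative_within_convex_directional) (auto simp: gradient_on_def)
    show "(?c \<longlongrightarrow> ?c 0) (at_right 0)"
      by (intro tendsto_intros)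
    have "(\<psi> (y + t *\<^sub>R (x - y)) - \<psi> y) / t \<le> ?c t" if t: "0 < t" "t < 1" for t
    proof -
      have "t *\<^sub>R x + (1 - t) *\<^sub>R y = y + t *\<^sub>R (x - y)"
        by (simp add: algebra_simps)
      moreover have "\<psi> (t *\<^sub>R x + (1 - t) *\<^sub>R y)
          \<le> t * \<psi> x + (1 - t) * \<psi> y - \<sigma> / 2 * t * (1 - t) * (norm (x - y))\<^sup>2"
        using assms(3,4,5) t by (simp add: strongly_convex_on_def)
      ultimately have "\<psi> (y + t *\<^sub>R (x - y)) - \<psi> y \<le> ?c t * t"
        by (simp add: algebra_simps)
      then show ?thesis
        using t by (simp add: pos_divide_le_eq)
    qed
    then show "eventually (\<lambda>t. (\<psi> (y + t *\<^sub>R (x - y)) - \<psi> y) / t \<le> ?c t) (at_right 0)"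
      unfolding eventually_at_right_field by (intro exI[of _ 1]) auto
  qed simp
  then show ?thesis
    by (simp add: bregman_def)
qed

section \<open>One mirror descent step\<close>

lemma mirror_step_in:
  "mirror_step Q \<psi> d\<psi> y h xk xn \<Longrightarrow> xn \<in> Q"
  by (simp add: mirror_step_def is_arg_min_def)

lemma mirror_steps_in:
  fixes x :: "nat \<Rightarrow> 'a::real_normed_vector"
  assumes "x 1 \<in> Q" "\<forall>k\<in>{1..N}. mirror_step Q \<psi> d\<psi> (y k) (\<gamma> k) (x k) (x (k + 1))"
    and "1 \<le> k" "k \<le> N + 1"
  shows "x k \<in> Q"
  using assms(3,4)
proof (induction k rule: nat_induct_at_least)
  case base
  show ?case
    using assms(1) by simp
next
  case (Suc k)
  then have "mirror_step Q \<psi> d\<psi> (y k) (\<gamma> k) (x k) (x (k + 1))"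
    using assms(2) by simp
  then show ?case
    using mirror_step_in by fastforce
qed

text \<open>Split \<open>xk - u\<close> at \<open>xn\<close>. Optimality controls the part
  \<open>xn - u\<close> and leaves a negative multiple of the squared distance from
  \<open>xk\<close> to \<open>xn\<close>; this pays for the quadratic term that Young's inequality
  produces on the part \<open>xk - xn\<close>.\<close>

lemma mirror_step_bound:
  assumes Q: "convex Q" and grad: "gradient_on Q \<psi> d\<psi>"
    and sc: "\<sigma> > 0" "strongly_convex_on Q \<sigma> \<psi>"
    and h: "h > 0" and step: "mirror_step Q \<psi> d\<psi> y h xk xn"
    and xk: "xk \<in> Q" and u: "u \<in> Q"
  shows "blinfun_apply y (xk - u)
    \<le> 1 / h * (bregman \<psi> d\<psi> u xk - bregman \<psi> d\<psi> u xn) + h / (2 * \<sigma>) * (norm y)\<^sup>2"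
proof -
  let ?V = "bregman \<psi> d\<psi>"
  define d where "d = norm (xk - xn)"
  have xn: "xn \<in> Q"
    using mirror_step_in[OF step] .
  have "(\<psi> has_derivative blinfun_apply (d\<psi> xn)) (at xn within Q)"
    using grad xn by (simp add: gradient_on_def)
  then have "((\<lambda>z. blinfun_apply y z + 1 / h * ?V z xk) has_derivative
      (\<lambda>v. blinfun_apply y v + 1 / h * (blinfun_apply (d\<psi> xn) v - blinfun_apply (d\<psi> xk) v)))
      (at xn within Q)"
    unfolding bregman_def by (auto intro!: derivative_eq_intros simp: h[THEN less_imp_neq, symmetric] blinfun.bilinear_simps)
  from is_arg_min_convex_derivative_nonneg[OF Q step[unfolded mirror_step_def] u this]
  have "blinfun_apply y (xn - u)
      \<le> 1 / h * (blinfun_apply (d\<psi> xn) (u - xn) - blinfun_apply (d\<psi> xk) (u - xn))"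
    by (simp add: blinfun.bilinear_simps)
  \<comment> \<open>Three-point identity of the Bregman divergence.\<close>
  also have "\<dots> = 1 / h * (?V u xk - ?V u xn) - 1 / h * ?V xn xk"
    unfolding bregman_def blinfun.diff_right right_diff_distrib by simp
  also have "\<dots> \<le> 1 / h * (?V u xk - ?V u xn) - 1 / h * (\<sigma> / 2 * d\<^sup>2)"
    using bregman_strongly_convex_ge[OF Q grad sc(2) xn xk] h
    by (intro diff_left_mono mult_left_mono) (simp_all add: d_def norm_minus_commute)
  finally have opt: "blinfun_apply y (xn - u)
      \<le> 1 / h * (?V u xk - ?V u xn) - 1 / h * (\<sigma> / 2 * d\<^sup>2)" .
  have "blinfun_apply y (xk - xn) \<le> norm y * d"
    using norm_blinfun[of y "xk - xn"] by (simp add: d_def)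
  also have "\<dots> \<le> h / (2 * \<sigma>) * (norm y)\<^sup>2 + 1 / h * (\<sigma> / 2 * d\<^sup>2)"
  proof -
    \<comment> \<open>Young's inequality, with weights chosen so that the \<open>d\<close> term is
      exactly the one subtracted in \<open>opt\<close>.\<close>
    have "0 \<le> (h * norm y - \<sigma> * d)\<^sup>2 / (2 * \<sigma> * h)"
      using h sc(1) by simp
    also have "\<dots> = h / (2 * \<sigma>) * (norm y)\<^sup>2 + 1 / h * (\<sigma> / 2 * d\<^sup>2) - norm y * d"
      using h sc(1) by (simp add: field_simps power2_eq_square)
    finally show ?thesis
      by simp
  qed
  finally show ?thesis
    using opt by (simp add: blinfun.diff_right)
qed

section \<open>Weighted telescoping\<close>

lemma sum_weighted_differences_le:
  fixes a v :: "nat \<Rightarrow> real"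
  assumes "\<And>k. 1 \<le> k \<Longrightarrow> k < N \<Longrightarrow> a k \<le> a (Suc k)"
    and "\<And>k. 1 \<le> k \<Longrightarrow> k \<le> N \<Longrightarrow> a k \<ge> 0"
    and "\<And>k. 1 \<le> k \<Longrightarrow> k \<le> N \<Longrightarrow> v k \<le> R"
    and "v (Suc N) \<ge> 0" "N \<ge> 1"
  shows "(\<Sum>k=1..N. a k * (v k - v (Suc k))) \<le> a N * R"
proof -
  \<comment> \<open>The induction needs the term with \<open>v (Suc n)\<close>: as
    \<open>R - v (Suc n)\<close> is nonnegative, the weight \<open>a n\<close> may be raised to
    \<open>a (Suc n)\<close>, and the next summand then telescopes. Only at \<open>n = N\<close> is
    this term dropped.\<close>
  have "(\<Sum>k=1..n. a k * (v k - v (Suc k))) \<le> a n * (R - v (Suc n))" if "1 \<le> n" "n \<le> N" for n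
    using that
  proof (induction n rule: nat_induct_at_least)
    case base
    then show ?case
      using assms(2,3)[of 1] by (auto intro: mult_left_mono)
  next
    case (Suc n)
    have "a n * (R - v (Suc n)) \<le> a (Suc n) * (R - v (Suc n))"
      using Suc assms(1)[of n] assms(3)[of "Suc n"] by (intro mult_right_mono) auto
    then show ?case
      using Suc by (simp add: algebra_simps)
  qed
  from this[of N] show ?thesis
    using assms(2)[of N] mult_nonneg_nonneg[OF _ assms(4), of "a N"] assms(5)
    by (auto simp: algebra_simps)
qed

text \<open>The directions \<open>y k\<close> are arbitrary, so productive and nonproductive steps
  are handled as a single run.\<close>

lemma weighted_mirror_descent_bound:
  fixes x :: "nat \<Rightarrow> 'a::real_normed_vector" and y :: "nat \<Rightarrow> 'a \<Rightarrow>\<^sub>L real"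
  assumes Q: "convex Q" and grad: "gradient_on Q \<psi> d\<psi>"
    and sc: "\<sigma> > 0" "strongly_convex_on Q \<sigma> \<psi>"
    and R: "\<forall>u\<in>Q. \<forall>v\<in>Q. bregman \<psi> d\<psi> u v \<le> R"
    and m: "m \<ge> -1" and N: "N \<ge> 1"
    and pos: "\<forall>k\<in>{1..N}. \<gamma> k > 0" and dec: "antimono_on {1..N} \<gamma>"
    and x1: "x 1 \<in> Q"
    and steps: "\<forall>k\<in>{1..N}. mirror_step Q \<psi> d\<psi> (y k) (\<gamma> k) (x k) (x (k + 1))"
    and u: "u \<in> Q"
  shows "(\<Sum>k=1..N. \<gamma> k powr (- m) * blinfun_apply (y k) (x k - u))
    \<le> R / \<gamma> N powr (m + 1) + 1 / (2 * \<sigma>) * (\<Sum>k=1..N. (norm (y k))\<^sup>2 / \<gamma> k powr (m - 1))"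
proof -
  let ?v = "\<lambda>k. bregman \<psi> d\<psi> u (x k)"
  let ?a = "\<lambda>k. \<gamma> k powr (- (m + 1))"
  have xQ: "x k \<in> Q" if "1 \<le> k" "k \<le> N + 1" for k
    using mirror_steps_in[OF x1 steps] that by simp
  have "\<gamma> k powr (- m) * blinfun_apply (y k) (x k - u)
      \<le> ?a k * (?v k - ?v (Suc k)) + 1 / (2 * \<sigma>) * ((norm (y k))\<^sup>2 / \<gamma> k powr (m - 1))"
    if k: "k \<in> {1..N}" for k
  proof -
    have g: "\<gamma> k > 0"
      using pos k by auto
    have "blinfun_apply (y k) (x k - u)
        \<le> 1 / \<gamma> k * (?v k - ?v (Suc k)) + \<gamma> k / (2 * \<sigma>) * (norm (y k))\<^sup>2"
      using mirror_step_bound[OF Q grad sc g _ xQ u, of "y k" k "x (k + 1)"] steps k by auto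
    then have "\<gamma> k powr (- m) * blinfun_apply (y k) (x k - u) \<le> \<gamma> k powr (- m) *
        (1 / \<gamma> k * (?v k - ?v (Suc k)) + \<gamma> k / (2 * \<sigma>) * (norm (y k))\<^sup>2)"
      by (intro mult_left_mono) auto
    also have "\<dots> = (\<gamma> k powr (- m) / \<gamma> k) * (?v k - ?v (Suc k))
        + 1 / (2 * \<sigma>) * ((norm (y k))\<^sup>2 * (\<gamma> k powr (- m) * \<gamma> k))"
      by (simp add: algebra_simps)
    also have "\<gamma> k powr (- m) / \<gamma> k = ?a k"
      using g powr_diff[of "\<gamma> k" "- m" 1] by simp
    also have "\<gamma> k powr (- m) * \<gamma> k = inverse (\<gamma> k powr (m - 1))"
      using g powr_add[of "\<gamma> k" "- m" 1] powr_minus[of "\<gamma> k" "m - 1"]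
      by (simp add: algebra_simps)
    finally show ?thesis
      by (simp only: divide_inverse)
  qed
  then have "(\<Sum>k=1..N. \<gamma> k powr (- m) * blinfun_apply (y k) (x k - u))
      \<le> (\<Sum>k=1..N. ?a k * (?v k - ?v (Suc k)))
        + 1 / (2 * \<sigma>) * (\<Sum>k=1..N. (norm (y k))\<^sup>2 / \<gamma> k powr (m - 1))"
    unfolding sum_distrib_left sum.distrib[symmetric] by (rule sum_mono)
  also have "(\<Sum>k=1..N. ?a k * (?v k - ?v (Suc k))) \<le> ?a N * R"
  proof (rule sum_weighted_differences_le)
    \<comment> \<open>Since \<open>m + 1\<close> is nonnegative, the exponent is nonpositive and
      non-increasing step sizes give nondecreasing weights.\<close>
    show "?a k \<le> ?a (Suc k)" if k: "1 \<le> k" "k < N" for k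
    proof (rule powr_mono2')
      show "\<gamma> (Suc k) \<le> \<gamma> k"
        using dec k by (auto simp: monotone_on_def)
    qed (use m pos k in auto)
    show "?v k \<le> R" if "1 \<le> k" "k \<le> N" for k
      using R u xQ that by simp
    have "0 \<le> \<sigma> / 2 * (norm (u - x (Suc N)))\<^sup>2"
      using sc by simp
    also have "\<dots> \<le> ?v (Suc N)"
      using bregman_strongly_convex_ge[OF Q grad sc(2) u] xQ by simp
    finally show "0 \<le> ?v (Suc N)" .
  qed (use N in auto)
  also have "?a N * R = R / \<gamma> N powr (m + 1)"
    using powr_minus_divide[of "\<gamma> N" "m + 1"] by simp
  finally show ?thesis
    by simp
qed

section \<open>Constraint bound and gap estimate\<close>

text \<open>Each component satisfies the bound with its own constant, which is at most the largest
  one. With \<open>v\<close> feasible, this limits the constraint violation anywhere on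
  \<open>Q\<close>.\<close>

lemma max_lipschitz_le:
  fixes gs :: "'i \<Rightarrow> 'a::real_normed_vector \<Rightarrow> real"
  assumes "finite A" "A \<noteq> {}" "\<forall>i\<in>A. M i \<ge> 0 \<and> (M i)-lipschitz_on Q (gs i)" "u \<in> Q" "v \<in> Q"
    and D: "norm (u - v) \<le> D"
  shows "(MAX i\<in>A. gs i u) \<le> (MAX i\<in>A. gs i v) + (MAX i\<in>A. M i) * D"
proof -
  have "gs i u \<le> (MAX i\<in>A. gs i v) + (MAX i\<in>A. M i) * D" if i: "i \<in> A" for i
  proof -
    have "gs i u - gs i v \<le> M i * norm (u - v)"
      using lipschitz_onD[of "M i" Q "gs i" u v] assms i by (auto simp: dist_norm)
    moreover have "M i * norm (u - v) \<le> (MAX i\<in>A. M i) * D"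
      using D assms(1,3) i order_trans[OF _ Max_ge[of "M ` A" "M i"], of 0]
      by (intro mult_mono) auto
    moreover have "gs i v \<le> (MAX i\<in>A. gs i v)"
      using assms(1) i by simp
    ultimately show ?thesis
      by linarith
  qed
  then show ?thesis
    using assms(1,2) by simp
qed

theorem theorem4p2:
  fixes Q :: "'a::real_normed_vector set"
    and \<psi> :: "'a \<Rightarrow> real" and d\<psi> :: "'a \<Rightarrow> 'a \<Rightarrow>\<^sub>L real"
    and F :: "'a \<Rightarrow> 'a \<Rightarrow>\<^sub>L real"
    and g :: "'a \<Rightarrow> real" and gs :: "nat \<Rightarrow> 'a \<Rightarrow> real" and M :: "nat \<Rightarrow> real"
    and p N :: nat and D R \<sigma> \<delta> L_F M_g \<epsilon> m :: real
    and \<gamma>F \<gamma>g \<gamma> :: "nat \<Rightarrow> real"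
    and x :: "nat \<Rightarrow> 'a" and G :: "nat \<Rightarrow> 'a \<Rightarrow>\<^sub>L real"
    and I J :: "nat set" and xhat :: 'a and B :: real
  assumes fin_dim: "\<exists>S :: 'a set. finite S \<and> span S = UNIV"
    and Q: "Q \<noteq> {}" "convex Q" "compact Q"
    and diam: "D > 0" "\<forall>u\<in>Q. \<forall>v\<in>Q. norm (u - v) \<le> D"
    and prox: "closed (epigraph Q \<psi>)" "gradient_on Q \<psi> d\<psi>"
              "\<sigma> > 0" "strongly_convex_on Q \<sigma> \<psi>"
    and R: "R > 0" "\<forall>u\<in>Q. \<forall>v\<in>Q. bregman \<psi> d\<psi> u v \<le> R"
    and F_cont: "continuous_on Q F"
    and F_bounded: "L_F > 0" "\<forall>u\<in>Q. norm (F u) \<le> L_F"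
    and F_mono: "\<delta> \<ge> 0" "delta_monotone_on Q \<delta> F"
    and gs: "p \<ge> 1"
            "\<forall>i\<in>{1..p}. convex_on Q (gs i)"
            "\<forall>i\<in>{1..p}. \<forall>u\<in>Q. subdifferential Q (gs i) u \<noteq> {}"
            "\<forall>i\<in>{1..p}. M i > 0 \<and> (M i)-lipschitz_on Q (gs i)"
    and g: "\<forall>u\<in>Q. g u = (MAX i\<in>{1..p}. gs i u)"
    and M_g: "M_g = (MAX i\<in>{1..p}. M i)"
    and solvable: "\<exists>xs. vi_solution Q F g xs"
    and params: "\<epsilon> > 0" "m \<ge> -1" "N \<ge> 1"
    and steps_pos: "\<forall>k\<ge>1. \<gamma>F k > 0 \<and> \<gamma>g k > 0"
    and run: "switching_mirror_descent Q \<psi> d\<psi> F g \<epsilon> \<gamma>F \<gamma>g N x G"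
    and I: "I = productive_steps g \<epsilon> N x" "I \<noteq> {}"
    and J: "J = nonproductive_steps g \<epsilon> N x"
    and G_bound: "\<forall>k\<in>J. norm (G k) \<le> M_g"
    and \<gamma>: "\<forall>k\<in>{1..N}. \<gamma> k = (if k \<in> I then \<gamma>F k else \<gamma>g k)" "antimono_on {1..N} \<gamma>"
    and xhat: "xhat = (1 / (\<Sum>k\<in>I. \<gamma>F k powr (- m))) *\<^sub>R (\<Sum>k\<in>I. (\<gamma>F k powr (- m)) *\<^sub>R x k)"
    and B: "B = 1 / (\<Sum>k\<in>I. \<gamma>F k powr (- m)) *
              (R / \<gamma> N powr (m + 1)
               + 1 / (2 * \<sigma>) * (\<Sum>k\<in>I. (norm (F (x k)))\<^sup>2 / \<gamma>F k powr (m - 1))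
               + 1 / (2 * \<sigma>) * (\<Sum>k\<in>J. (norm (G k))\<^sup>2 / \<gamma>g k powr (m - 1))
               - (\<epsilon> - M_g * D) * (\<Sum>k\<in>J. \<gamma>g k powr (- m)))
              + \<delta>"
  shows "Gap Q F xhat \<le> B \<and> (J \<noteq> {} \<longrightarrow> Gap Q F xhat < B)"
proof -
  have prod_iff: "k \<in> I \<longleftrightarrow> k \<in> {1..N} \<and> g (x k) \<le> \<epsilon>"
    and nonprod_iff: "k \<in> J \<longleftrightarrow> k \<in> {1..N} \<and> \<epsilon> < g (x k)" for k
    by (auto simp: I J productive_steps_def nonproductive_steps_def)
  have fin: "finite I" "finite J"
    by (auto simp: I J productive_steps_def nonproductive_steps_def)
  have IJ: "I \<inter> J = {}" "I \<union> J = {1..N}"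
    using prod_iff nonprod_iff by force+
  have split: "sum f {1..N} = sum f I + sum f J" for f :: "nat \<Rightarrow> real"
    using sum.union_disjoint[OF fin IJ(1), of f] IJ(2) by simp
  have \<gamma>I: "\<gamma> k = \<gamma>F k" if "k \<in> I" for k
    using \<gamma>(1) that prod_iff by auto
  have \<gamma>J: "\<gamma> k = \<gamma>g k" if "k \<in> J" for k
    using \<gamma>(1) that nonprod_iff IJ(1) by auto
  define y where "y = (\<lambda>k. if k \<in> I then F (x k) else G k)"
  have yI: "y k = F (x k)" if "k \<in> I" for k
    using that by (simp add: y_def)
  have yJ: "y k = G k" if "k \<in> J" for k
    using that IJ(1) by (auto simp: y_def)
  have x1: "x 1 \<in> Q"
    using run by (simp add: switching_mirror_descent_def)
  have steps: "\<forall>k\<in>{1..N}. mirror_step Q \<psi> d\<psi> (y k) (\<gamma> k) (x k) (x (k + 1))"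
    using run \<gamma>(1) prod_iff by (auto simp: switching_mirror_descent_def y_def split: if_splits)
  have xQ: "x k \<in> Q" if "k \<in> {1..N}" for k
    using mirror_steps_in[OF x1 steps] that by simp
  have pos: "\<forall>k\<in>{1..N}. \<gamma> k > 0"
    using \<gamma>(1) steps_pos by auto
  obtain xs where xs: "xs \<in> Q" "g xs \<le> 0"
    using solvable by (auto simp: vi_solution_def)
  have g_le: "g u \<le> M_g * D" if u: "u \<in> Q" for u
  proof -
    have "g u \<le> g xs + M_g * D"
      using max_lipschitz_le[of "{1..p}" M Q gs u xs D] gs(1,4) g M_g diam(2) u xs(1)
      by (auto simp: less_imp_le)
    then show ?thesis
      using xs(2) by simp
  qed

  define S where "S = (\<Sum>k\<in>I. \<gamma>F k powr (- m))"
  have S: "S > 0"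
    unfolding S_def using fin(1) I(2)
  proof (rule sum_pos)
    show "0 < \<gamma>F k powr (- m)" if "k \<in> I" for k
      using that prod_iff steps_pos by fastforce
  qed
  define W where "W = (\<Sum>k\<in>J. \<gamma>g k powr (- m))"
  \<comment> \<open>The excess of the violation over \<open>\<epsilon>\<close> is kept because it
    does not involve the comparison point \<open>u\<close>.\<close>
  define slack where "slack = (\<Sum>k\<in>J. \<gamma>g k powr (- m) * (g (x k) - \<epsilon>))"
  define T where "T = R / \<gamma> N powr (m + 1)
      + 1 / (2 * \<sigma>) * (\<Sum>k\<in>I. (norm (F (x k)))\<^sup>2 / \<gamma>F k powr (m - 1))
      + 1 / (2 * \<sigma>) * (\<Sum>k\<in>J. (norm (G k))\<^sup>2 / \<gamma>g k powr (m - 1))"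
  have B': "B = 1 / S * (T - (\<epsilon> - M_g * D) * W) + \<delta>"
    unfolding B S_def T_def W_def ..

  \<comment> \<open>A margin uniform in \<open>u\<close> is subtracted here, since pointwise strict
    inequalities alone could become an equality in the supremum.\<close>
  have bound: "blinfun_apply (F u) (xhat - u) \<le> B - slack / S" if u: "u \<in> Q" for u
  proof -
    let ?f = "\<lambda>k. \<gamma> k powr (- m) * blinfun_apply (y k) (x k - u)"
    have "sum ?f I + sum ?f J \<le> R / \<gamma> N powr (m + 1)
        + 1 / (2 * \<sigma>) * (\<Sum>k=1..N. (norm (y k))\<^sup>2 / \<gamma> k powr (m - 1))"
      using weighted_mirror_descent_bound[OF Q(2) prox(2-4) R(2) params(2,3) pos \<gamma>(2) x1 steps u]
      unfolding split .
    also have "\<dots> = T"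
      unfolding T_def split by (simp add: \<gamma>I \<gamma>J yI yJ add_divide_distrib)
    finally have upper: "sum ?f I + sum ?f J \<le> T" .
    \<comment> \<open>Inserting \<open>\<epsilon>\<close> splits \<open>g (x k) - M_g * D\<close>
      into the slack and the term \<open>\<epsilon> - M_g * D\<close> that appears in
      \<open>B\<close>.\<close>
    have "slack + (\<epsilon> - M_g * D) * W = (\<Sum>k\<in>J. \<gamma>g k powr (- m) * (g (x k) - M_g * D))"
      unfolding slack_def W_def sum_distrib_left sum.distrib[symmetric]
      by (simp add: algebra_simps)
    also have "\<dots> \<le> sum ?f J"
    proof (rule sum_mono)
      fix k assume k: "k \<in> J"
      then have "G k \<in> subdifferential Q g (x k)"
        using run nonprod_iff by (fastforce simp: switching_mirror_descent_def)
      then have "g (x k) + blinfun_apply (G k) (u - x k) \<le> g u"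
        using u by (simp add: subdifferential_def)
      then have "g (x k) - M_g * D \<le> blinfun_apply (G k) (x k - u)"
        using g_le[OF u] by (simp add: blinfun.diff_right)
      then show "\<gamma>g k powr (- m) * (g (x k) - M_g * D) \<le> ?f k"
        using k by (auto simp: \<gamma>J yJ intro!: mult_left_mono)
    qed
    finally have lowerJ: "slack + (\<epsilon> - M_g * D) * W \<le> sum ?f J" .
    have S_xhat: "S *\<^sub>R xhat = (\<Sum>k\<in>I. (\<gamma>F k powr (- m)) *\<^sub>R x k)"
      using S by (simp add: xhat S_def)
    have "S *\<^sub>R (xhat - u) = (\<Sum>k\<in>I. (\<gamma>F k powr (- m)) *\<^sub>R (x k - u))"
      unfolding scaleR_right_diff_distrib S_xhat
      by (simp add: sum_subtractf S_def scaleR_sum_left)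
    then have "S * blinfun_apply (F u) (xhat - u)
        = blinfun_apply (F u) (\<Sum>k\<in>I. (\<gamma>F k powr (- m)) *\<^sub>R (x k - u))"
      by (metis blinfun.scaleR_right real_scaleR_def)
    also have "\<dots> = (\<Sum>k\<in>I. \<gamma>F k powr (- m) * blinfun_apply (F u) (x k - u))"
      by (simp add: blinfun.sum_right blinfun.scaleR_right)
    \<comment> \<open>The weights sum to \<open>S\<close>, so a loss of \<open>\<delta>\<close> per
      productive step totals \<open>\<delta> * S\<close>, which becomes \<open>\<delta>\<close>
      after normalization.\<close>
    also have "\<dots> - \<delta> * S
        = (\<Sum>k\<in>I. \<gamma>F k powr (- m) * (blinfun_apply (F u) (x k - u) - \<delta>))"
      by (simp add: S_def sum_distrib_left sum_subtractf right_diff_distrib mult.commute)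
    also have "\<dots> \<le> sum ?f I"
    proof (rule sum_mono)
      fix k assume k: "k \<in> I"
      then have "- \<delta> \<le> blinfun_apply (F (x k) - F u) (x k - u)"
        using F_mono(2) u xQ prod_iff by (simp add: delta_monotone_on_def)
      then have "blinfun_apply (F u) (x k - u) - \<delta> \<le> blinfun_apply (F (x k)) (x k - u)"
        by (simp add: blinfun.diff_left)
      then show "\<gamma>F k powr (- m) * (blinfun_apply (F u) (x k - u) - \<delta>) \<le> ?f k"
        using k by (auto simp: \<gamma>I yI intro!: mult_left_mono)
    qed
    finally have "S * blinfun_apply (F u) (xhat - u)
        \<le> T - (\<epsilon> - M_g * D) * W - slack + \<delta> * S"
      using upper lowerJ by linarith
    also have "\<dots> = S * (B - slack / S)"
      using S by (simp add: B' field_simps)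
    finally show ?thesis
      using S by (simp add: mult_le_cancel_left_pos)
  qed
  have Gap_le: "Gap Q F xhat \<le> B - slack / S"
    unfolding Gap_def using Q(1) bound by (rule cSUP_least)
  have pos_term: "\<gamma>g k powr (- m) * (g (x k) - \<epsilon>) > 0" if "k \<in> J" for k
    using that nonprod_iff steps_pos by fastforce
  then have "slack \<ge> 0"
    unfolding slack_def by (intro sum_nonneg less_imp_le)
  \<comment> \<open>For empty \<open>J\<close> the slack vanishes and equality can occur: take
    \<open>Q = [0,1]\<close>, \<psi>(t) = t^2/2, \<open>F\<close> the constant functional 1,
    \<open>g = 0\<close>, \<delta> = 0, \<open>N = 1\<close>, initial point 1, step size 1, \<sigma>
    = 1 and \<open>R = 1/2\<close>. Then the gap and \<open>B\<close> are both 1.\<close>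
  moreover have "slack > 0" if "J \<noteq> {}"
    unfolding slack_def using fin(2) that pos_term by (rule sum_pos)
  ultimately have "slack / S \<ge> 0" "J \<noteq> {} \<Longrightarrow> slack / S > 0"
    using S by simp_all
  then show ?thesis
    using Gap_le by (cases "J = {}") auto
qed

end
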